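(* In the model defined in the context, the bivariate marginal maximum likelihood (BML) estimator $\hat\beta$ is a weakly consistent estimator of the model's parameter $\beta$; that is, $\hat\beta\to\beta$ in probability as the number of pairs $q\to\infty$.
   Context: Setting: $y_i=\beta x_i+\varepsilon_i$ with scalar parameter $\beta$, scalar observations $y_i$ and non-stochastic scalar $x_i$ (both centered on their expected values), $i$ indexing spatial units. From the spatial units, $q$ disjoint pairs of neighboring units are selected ("bivariate coding"); the $i$-th pair consists of unit $i$ ($i=1,\dots,q$) and a neighbor $l=l(i)$ of unit $i$, so there are $2q$ distinct units. Within each pair, $(\varepsilon_i,\varepsilon_l)$ is bivariate Gaussian with mean $0$ and covariance matrix $\sigma^2\begin{pmatrix}1&\psi\\ \psi&1\end{pmatrix}$, $\sigma^2>0$, $|\psi|<1$; distinct pairs are stochastically independent. The sample size is $2q$. Statistics (sums over the pairs $i=1,\dots,q$ with $l=l(i)$): $\alpha_1=\sum(x_i^2+x_l^2)>0$, $\alpha_2=\sum(y_i^2+y_l^2)$, $\alpha_3=\sum(x_iy_i+x_ly_l)$, $\alpha_4=\sum(x_iy_l+x_ly_i)$, $\alpha_5=\sum x_ix_l$, $\alpha_6=\sum y_iy_l$. The BML estimators $(\hat\beta,\hat\sigma^2,\hat\psi)$ (depending on $q$) are given by the solution of the system $$\hat\beta=\frac{\hat\psi\alpha_4-\alpha_3}{2\hat\psi\alpha_5-\alpha_1},\quad \hat\sigma^2=\frac{\alpha_2+\hat\beta^2\alpha_1-2\hat\beta\alpha_3-2\hat\psi\alpha_6-2\hat\psi\hat\beta^2\alpha_5+2\hat\psi\hat\beta\alpha_4}{2q(1-\hat\psi^2)},\quad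 \hat\psi=\frac{\alpha_6-\hat\beta\alpha_4+\hat\beta^2\alpha_5}{q\hat\sigma^2},$$ with $\hat\sigma^2>0$, $|\hat\psi|<1$.
   Formalization: The formal theorem adds the assumption that α₁ → ∞ as q → ∞; with only α₁ > 0 the claim is false (e.g. x = 1 and −1 on the first pair and 0 elsewhere makes β̂ − β a fixed nondegenerate Gaussian for every q). *)

theory Defs
  imports "HOL-Probability.Probability"
begin

text \<open>
  The type \<open>'s\<close> is the type of spatial units. A coding with \<open>q\<close> pairs is given by two functions
  \<open>u, l\<close> on pair indices: the \<open>i\<close>-th pair, \<open>i = 1, \<dots>, q\<close>, consists of the unit \<open>u i\<close> and its
  neighbor \<open>l i\<close>. (So \<open>l\<close> takes the index of the pair, and there is no identification of the
  first units with the numbers \<open>1, \<dots>, q\<close>.)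
\<close>

definition bivariate_coding ::
    "('s \<times> 's) set \<Rightarrow> nat \<Rightarrow> (nat \<Rightarrow> 's) \<Rightarrow> (nat \<Rightarrow> 's) \<Rightarrow> bool" where
  "bivariate_coding N q u l \<longleftrightarrow>
     (\<forall>i\<in>{1..q}. (u i, l i) \<in> N) \<and>
     inj_on u {1..q} \<and> inj_on l {1..q} \<and> u ` {1..q} \<inter> l ` {1..q} = {}"

text \<open>
  Lebesgue density of the bivariate normal distribution with mean \<open>0\<close> and covariance matrix
  \<open>v * (1, \<psi>; \<psi>, 1)\<close>, whose determinant is \<open>v\<^sup>2 * (1 - \<psi>\<^sup>2)\<close>; it is a density for \<open>v > 0\<close> and
  \<open>\<bar>\<psi>\<bar> < 1\<close>.
\<close>

definition bivariate_normal_density :: "real \<Rightarrow> real \<Rightarrow> real \<times> real \<Rightarrow> real" where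
  "bivariate_normal_density v \<psi> = (\<lambda>(a, b).
     1 / (2 * pi * v * sqrt (1 - \<psi>\<^sup>2)) *
     exp (- (a\<^sup>2 - 2 * \<psi> * a * b + b\<^sup>2) / (2 * v * (1 - \<psi>\<^sup>2))))"

definition pairwise_gaussian_errors ::
    "'a measure \<Rightarrow> nat \<Rightarrow> (nat \<Rightarrow> 's) \<Rightarrow> (nat \<Rightarrow> 's) \<Rightarrow> ('s \<Rightarrow> 'a \<Rightarrow> real) \<Rightarrow> real \<Rightarrow> real \<Rightarrow> bool"
  where
  "pairwise_gaussian_errors M q u l \<epsilon> v \<psi> \<longleftrightarrow>
     (\<forall>i\<in>{1..q}. distributed M lborel (\<lambda>\<omega>. (\<epsilon> (u i) \<omega>, \<epsilon> (l i) \<omega>))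
                    (\<lambda>z. ennreal (bivariate_normal_density v \<psi> z))) \<and>
     prob_space.indep_vars M (\<lambda>_. borel) (\<lambda>i \<omega>. (\<epsilon> (u i) \<omega>, \<epsilon> (l i) \<omega>)) {1..q}"

text \<open>In the following statistics, \<open>y\<close> is a realization of the observations.\<close>

definition alpha1 :: "nat \<Rightarrow> (nat \<Rightarrow> 's) \<Rightarrow> (nat \<Rightarrow> 's) \<Rightarrow> ('s \<Rightarrow> real) \<Rightarrow> real" where
  "alpha1 q u l x = (\<Sum>i=1..q. (x (u i))\<^sup>2 + (x (l i))\<^sup>2)"

definition alpha2 :: "nat \<Rightarrow> (nat \<Rightarrow> 's) \<Rightarrow> (nat \<Rightarrow> 's) \<Rightarrow> ('s \<Rightarrow> real) \<Rightarrow> real" where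
  "alpha2 q u l y = (\<Sum>i=1..q. (y (u i))\<^sup>2 + (y (l i))\<^sup>2)"

definition alpha3 ::
    "nat \<Rightarrow> (nat \<Rightarrow> 's) \<Rightarrow> (nat \<Rightarrow> 's) \<Rightarrow> ('s \<Rightarrow> real) \<Rightarrow> ('s \<Rightarrow> real) \<Rightarrow> real" where
  "alpha3 q u l x y = (\<Sum>i=1..q. x (u i) * y (u i) + x (l i) * y (l i))"

definition alpha4 ::
    "nat \<Rightarrow> (nat \<Rightarrow> 's) \<Rightarrow> (nat \<Rightarrow> 's) \<Rightarrow> ('s \<Rightarrow> real) \<Rightarrow> ('s \<Rightarrow> real) \<Rightarrow> real" where
  "alpha4 q u l x y = (\<Sum>i=1..q. x (u i) * y (l i) + x (l i) * y (u i))"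

definition alpha5 :: "nat \<Rightarrow> (nat \<Rightarrow> 's) \<Rightarrow> (nat \<Rightarrow> 's) \<Rightarrow> ('s \<Rightarrow> real) \<Rightarrow> real" where
  "alpha5 q u l x = (\<Sum>i=1..q. x (u i) * x (l i))"

definition alpha6 :: "nat \<Rightarrow> (nat \<Rightarrow> 's) \<Rightarrow> (nat \<Rightarrow> 's) \<Rightarrow> ('s \<Rightarrow> real) \<Rightarrow> real" where
  "alpha6 q u l y = (\<Sum>i=1..q. y (u i) * y (l i))"

text \<open>
  \<open>v\<close> stands for the estimate of the variance \<open>\<sigma>\<^sup>2\<close>. For \<open>alpha1 > 0\<close>, \<open>v > 0\<close>, \<open>\<bar>p\<bar> < 1\<close> and
  \<open>q > 0\<close> no denominator vanishes, since \<open>2 * \<bar>alpha5\<bar> \<le> alpha1\<close>.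
\<close>

definition bml_solution ::
    "nat \<Rightarrow> (nat \<Rightarrow> 's) \<Rightarrow> (nat \<Rightarrow> 's) \<Rightarrow> ('s \<Rightarrow> real) \<Rightarrow> ('s \<Rightarrow> real) \<Rightarrow> real \<Rightarrow> real \<Rightarrow> real \<Rightarrow> bool"
  where
  "bml_solution q u l x y b v p \<longleftrightarrow>
     b = (p * alpha4 q u l x y - alpha3 q u l x y) / (2 * p * alpha5 q u l x - alpha1 q u l x) \<and>
     v = (alpha2 q u l y + b\<^sup>2 * alpha1 q u l x - 2 * b * alpha3 q u l x y
            - 2 * p * alpha6 q u l y - 2 * p * b\<^sup>2 * alpha5 q u l x + 2 * p * b * alpha4 q u l x y)
         / (2 * real q * (1 - p\<^sup>2)) \<and>
     p = (alpha6 q u l y - b * alpha4 q u l x y + b\<^sup>2 * alpha5 q u l x) / (real q * v) \<and>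
     v > 0 \<and> \<bar>p\<bar> < 1"

definition weakly_consistent :: "'a measure \<Rightarrow> (nat \<Rightarrow> 'a \<Rightarrow> real) \<Rightarrow> real \<Rightarrow> bool" where
  "weakly_consistent M T \<theta> \<longleftrightarrow>
     (\<forall>e>0. (\<lambda>q. measure M {\<omega> \<in> space M. \<bar>T q \<omega> - \<theta>\<bar> > e}) \<longlonglongrightarrow> 0)"

end

theory Submission
  imports Defs
begin

text \<open>
  Rotating each pair to sums and differences decouples the model into two regressions whose errors
  are independent across pairs. With \<open>S = \<Sum>(x\<^sub>u + x\<^sub>l)\<^sup>2\<close>, \<open>D = \<Sum>(x\<^sub>u - x\<^sub>l)\<^sup>2\<close>,
  \<open>P = \<Sum>(x\<^sub>u + x\<^sub>l)(\<epsilon>\<^sub>u + \<epsilon>\<^sub>l)\<close>, \<open>Q = \<Sum>(x\<^sub>u - x\<^sub>l)(\<epsilon>\<^sub>u - \<epsilon>\<^sub>l)\<close> and \<open>t\<close> the estimation error,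
  the residual sums of squares \<open>RS\<close> and \<open>RD\<close> of the two regressions are quadratic in \<open>t\<close>.
  Eliminating the estimates of \<open>\<sigma>\<^sup>2\<close> and \<open>\<psi>\<close> from the BML system leaves
  \<open>t (RD S + RS D) = RD P + RS Q\<close>, so \<open>t\<close> lies between the two least squares errors \<open>P/S\<close> and
  \<open>Q/D\<close>. Say \<open>D \<le> S\<close>. By Chebyshev, \<open>P\<^sup>2/S\<close> and \<open>Q\<^sup>2/D\<close> are bounded in probability, and the sums of
  squared errors are of exact order \<open>q\<close> (Markov from above, Chernoff from below). Then \<open>RD\<close> stays of
  order \<open>q\<close> even if the estimate of \<open>\<psi>\<close> is not controlled, and the equation forces
  \<open>t\<^sup>2 S\<close> to be bounded for each of its possibly several solutions, while \<open>S \<ge> alpha1 \<rightarrow> \<infinity>\<close>.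
\<close>

subsection \<open>Solutions of the BML system\<close>

text \<open>
  \<open>\<tau>\<close> is the distance of \<open>t\<close> to \<open>p = P/S\<close>, and \<open>L\<close> the distance of \<open>p\<close> to \<open>d = Q/D\<close>. Everything
  rests on \<open>L\<^sup>2 D \<le> 4 K\<close>: it absorbs the contribution of \<open>S \<tau>\<^sup>2\<close> to \<open>RS\<close>, which is not bounded by a
  multiple of \<open>n\<close>.
\<close>

lemma stationary_bound:
  fixes S D P Q ES ED n c C K t :: real
  assumes SD: "0 \<le> D" "D \<le> S" "0 < S"
    and PQ: "P\<^sup>2 \<le> K * S" "Q\<^sup>2 \<le> K * D"
    and E: "ES \<le> C * n" "c * n \<le> ED"
    and pos: "0 < RS" "0 < RD" "0 < n" "0 < c" "0 < C"
    and big: "10 * K \<le> c * n"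
    and RS: "RS = ES - 2 * t * P + t\<^sup>2 * S"
    and RD: "RD = ED - 2 * t * Q + t\<^sup>2 * D"
    and stationary: "t * (RD * S + RS * D) = RD * P + RS * Q"
  shows "t\<^sup>2 * S \<le> (1 + 4 * C / c)\<^sup>2 * K"
proof -
  have K: "0 \<le> K"
    using PQ(1) SD(3) by (smt (verit) mult_neg_pos zero_le_power2)
  \<comment> \<open>\<open>r\<close> is the scale of the goal: \<open>\<bar>P / S\<bar>\<close> is
    at most \<open>r\<close>, so it suffices to bound \<open>t - p\<close> by a multiple of
    \<open>r\<close>.\<close>
  define r where "r = sqrt (K / S)"
  have r: "0 \<le> r" "r\<^sup>2 = K / S" using K SD by (auto simp: r_def)
  define p where "p = P / S"
  have P: "P = p * S" using SD by (simp add: p_def)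
  have p: "p\<^sup>2 \<le> K / S"
    using PQ(1) SD(3) unfolding P by (simp add: power_mult_distrib power2_eq_square field_simps)
  then have p': "\<bar>p\<bar> \<le> r"
    by (metis r abs_le_square_iff abs_of_nonneg)
  have "\<bar>t - p\<bar> \<le> 4 * C / c * r"
  proof (cases "D = 0")
    \<comment> \<open>The second regression is void: \<open>Q\<close> vanishes with
      \<open>D\<close>, and the stationary equation leaves \<open>t = p\<close>.\<close>
    case True
    then have "Q = 0" using PQ(2) by simp
    then have "RD * (S * (t - p)) = 0" using stationary True P by (simp add: algebra_simps)
    then have "t = p" using pos SD by simp
    then show ?thesis using pos r by simp
  next
    case False
    then have D: "0 < D" using SD by simp
    define d where "d = Q / D"
    have Q: "Q = d * D" using D by (simp add: d_def)
    have d: "d\<^sup>2 * D \<le> K"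
      using PQ(2) D unfolding Q by (simp add: power_mult_distrib power2_eq_square)
    define L where "L = \<bar>d - p\<bar>"
    have pD: "p\<^sup>2 * D \<le> K"
    proof -
      have "p\<^sup>2 * D \<le> K / S * S" using p SD by (intro mult_mono) (auto simp: K)
      then show ?thesis using SD by simp
    qed
    have LD: "L\<^sup>2 * D \<le> 4 * K"
    proof -
      have "L\<^sup>2 \<le> 2 * d\<^sup>2 + 2 * p\<^sup>2"
        unfolding L_def using zero_le_power2[of "d + p"] by (simp add: power2_eq_square algebra_simps)
      then have "L\<^sup>2 * D \<le> (2 * d\<^sup>2 + 2 * p\<^sup>2) * D" using D by (intro mult_right_mono) auto
      then show ?thesis using d pD by (simp add: algebra_simps)
    qed
    \<comment> \<open>Hence \<open>t\<close> is the average of \<open>p\<close> and \<open>d\<close>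
      with the positive weights \<open>A\<close> and \<open>B\<close>; it lies between them, and
      both distances are at most \<open>L\<close>.\<close>
    have eq: "RD * S * (t - p) = RS * D * (d - t)"
      using stationary unfolding P Q by (simp add: algebra_simps)
    define A B where "A = RD * S" and "B = RS * D"
    have AB: "0 < A" "0 < B" using pos SD D by (auto simp: A_def B_def)
    have eqAB: "A * (t - p) = B * (d - t)" using eq A_def B_def by simp
    have "A * L = (A + B) * \<bar>d - t\<bar>"
    proof -
      have "(A + B) * (d - t) = A * (d - p)" using eqAB by (simp add: algebra_simps)
      then have "\<bar>(A + B) * (d - t)\<bar> = \<bar>A * (d - p)\<bar>" by simp
      then show ?thesis using AB by (simp add: abs_mult L_def)
    qed
    then have dt: "\<bar>d - t\<bar> \<le> L"
      using AB by (smt (verit) mult_less_cancel_left_pos mult_right_mono distrib_right zero_le_mult_iff)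
    have "B * L = (A + B) * \<bar>t - p\<bar>"
    proof -
      have "(A + B) * (t - p) = B * (d - p)" using eqAB by (simp add: algebra_simps)
      then have "\<bar>(A + B) * (t - p)\<bar> = \<bar>B * (d - p)\<bar>" by simp
      then show ?thesis using AB by (simp add: abs_mult L_def)
    qed
    then have tp: "\<bar>t - p\<bar> \<le> L"
      using AB by (smt (verit) mult_less_cancel_left_pos mult_right_mono distrib_right zero_le_mult_iff)
    define \<tau> where "\<tau> = \<bar>t - p\<bar>"
    \<comment> \<open>Completing the square at \<open>d\<close>: whatever \<open>t\<close> is, the
      residual sum is at least its minimum \<open>ED - d\<^sup>2 * D\<close>.\<close>
    have RD': "c * n - K \<le> RD"
    proof -
      have "RD = ED - d\<^sup>2 * D + D * (t - d)\<^sup>2"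
        unfolding RD Q by (simp add: power2_eq_square algebra_simps)
      moreover have "0 \<le> D * (t - d)\<^sup>2" using D by simp
      ultimately show ?thesis using E d by linarith
    qed
    have RS': "RS \<le> C * n + S * \<tau>\<^sup>2"
    proof -
      have "RS = ES - p\<^sup>2 * S + S * (t - p)\<^sup>2"
        unfolding RS P by (simp add: power2_eq_square algebra_simps)
      moreover have "0 \<le> p\<^sup>2 * S" using SD by simp
      ultimately show ?thesis using E by (simp add: \<tau>_def)
    qed
    have \<tau>: "0 \<le> \<tau>" "\<tau> \<le> L" using tp by (auto simp: \<tau>_def)
    have L0: "0 \<le> L" by (simp add: L_def)
    have "(c * n - K) * (S * \<tau>) \<le> RD * (S * \<tau>)"
      using RD' SD \<tau> by (intro mult_right_mono) auto
    also have "\<dots> = RS * D * \<bar>d - t\<bar>"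
    proof -
      have "\<bar>RD * S * (t - p)\<bar> = \<bar>RS * D * (d - t)\<bar>" using eq by simp
      then show ?thesis using pos SD by (simp add: abs_mult \<tau>_def mult.assoc)
    qed
    also have "\<dots> \<le> (C * n + S * \<tau>\<^sup>2) * D * L"
      using RS' dt D pos by (intro mult_mono) (auto intro!: mult_right_mono mult_nonneg_nonneg)
    also have "\<dots> = C * n * D * L + S * \<tau> * (\<tau> * L * D)"
      by (simp add: power2_eq_square algebra_simps)
    \<comment> \<open>The absorption: \<open>\<tau> * L * D \<le> L\<^sup>2 * D\<close> makes the
      excess linear in \<open>S * \<tau>\<close>. Moved to the left, it turns
      \<open>c * n - K\<close> into \<open>c * n - 5 * K\<close>, which \<open>big\<close> keeps at
      or above \<open>c * n / 2\<close>.\<close>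
    also have "\<dots> \<le> C * n * D * L + S * \<tau> * (4 * K)"
    proof -
      have "\<tau> * L * D \<le> L\<^sup>2 * D" using \<tau> L0 D by (auto simp: power2_eq_square intro!: mult_right_mono)
      then have "\<tau> * L * D \<le> 4 * K" using LD by linarith
      then show ?thesis using SD \<tau> by (intro add_left_mono mult_left_mono) auto
    qed
    finally have "(c * n - 5 * K) * (S * \<tau>) \<le> C * n * D * L" by (simp add: algebra_simps)
    moreover have "c * n / 2 * (S * \<tau>) \<le> (c * n - 5 * K) * (S * \<tau>)"
      using big SD \<tau> by (intro mult_right_mono) auto
    ultimately have "n * (c / 2 * S * \<tau>) \<le> n * (C * (D * L))" by (simp add: algebra_simps)
    then have 1: "c / 2 * S * \<tau> \<le> C * (D * L)" using pos by simp
    \<comment> \<open>Splitting the square as \<open>D\<close> times \<open>L\<^sup>2 * D\<close>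
      and using \<open>D \<le> S\<close> on the first factor brings the bound to the scale
      \<open>r * S\<close>.\<close>
    have "(D * L)\<^sup>2 \<le> (2 * (r * S))\<^sup>2"
    proof -
      have "(D * L)\<^sup>2 = D * (L\<^sup>2 * D)" by (simp add: power2_eq_square)
      also have "\<dots> \<le> S * (4 * K)" using LD SD D by (intro mult_mono[of D S "L\<^sup>2 * D"]) auto
      also have "\<dots> = (2 * (r * S))\<^sup>2" using r SD by (simp add: power_mult_distrib) (simp add: power2_eq_square)
      finally show ?thesis .
    qed
    then have "D * L \<le> 2 * (r * S)" by (rule power2_le_imp_le) (use r SD in simp)
    then have "C * (D * L) \<le> C * (2 * (r * S))" using pos by simp
    with 1 have "S * (c / 2 * \<tau>) \<le> S * (2 * C * r)" by (simp add: algebra_simps)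
    then have "c / 2 * \<tau> \<le> 2 * C * r" using SD by simp
    then show ?thesis using pos by (simp add: \<tau>_def field_simps)
  qed
  then have "\<bar>t\<bar> \<le> (1 + 4 * C / c) * r" using p' by (simp add: algebra_simps)
  then have "t\<^sup>2 \<le> ((1 + 4 * C / c) * r)\<^sup>2" by (metis abs_ge_zero power2_abs power_mono)
  also have "\<dots> = (1 + 4 * C / c)\<^sup>2 * (K / S)" by (simp add: power_mult_distrib r)
  finally show ?thesis using SD by (simp add: field_simps)
qed

text \<open>The system amounts to \<open>RS = 2 q v (1 + p)\<close> and \<open>RD = 2 q v (1 - p)\<close>.\<close>

lemma bml_solution_stationary:
  fixes q :: nat and \<beta> :: real
  assumes sol: "bml_solution q u l x (\<lambda>s. \<beta> * x s + e s) b v p"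
    and q: "q \<ge> 1" and a1: "0 < alpha1 q u l x"
  defines "S \<equiv> \<Sum>i=1..q. (x (u i) + x (l i))\<^sup>2" and "D \<equiv> \<Sum>i=1..q. (x (u i) - x (l i))\<^sup>2"
    and "P \<equiv> \<Sum>i=1..q. (x (u i) + x (l i)) * (e (u i) + e (l i))"
    and "Q \<equiv> \<Sum>i=1..q. (x (u i) - x (l i)) * (e (u i) - e (l i))"
    and "ES \<equiv> \<Sum>i=1..q. (e (u i) + e (l i))\<^sup>2" and "ED \<equiv> \<Sum>i=1..q. (e (u i) - e (l i))\<^sup>2"
    and "t \<equiv> b - \<beta>"
  defines "RS \<equiv> ES - 2 * t * P + t\<^sup>2 * S" and "RD \<equiv> ED - 2 * t * Q + t\<^sup>2 * D"
  shows "0 < RS" "0 < RD" "t * (RD * S + RS * D) = RD * P + RS * Q" "S + D = 2 * alpha1 q u l x"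
proof -
  define y where "y = (\<lambda>s. \<beta> * x s + e s)"
  have S0: "0 \<le> S" "0 \<le> D" unfolding S_def D_def by (auto intro: sum_nonneg)
  \<comment> \<open>Polarization in each pair: all six statistics become combinations of the sum and
    difference quantities.\<close>
  have a1': "alpha1 q u l x = (S + D) / 2"
    unfolding alpha1_def S_def D_def sum.distrib[symmetric] sum_divide_distrib
    by (intro sum.cong) (auto simp: power2_eq_square algebra_simps)
  have a5: "alpha5 q u l x = (S - D) / 4"
    unfolding alpha5_def S_def D_def sum_subtractf[symmetric] sum_divide_distrib
    by (intro sum.cong) (auto simp: power2_eq_square algebra_simps)
  have a3: "alpha3 q u l x y = \<beta> * (S + D) / 2 + (P + Q) / 2"
    unfolding alpha3_def S_def D_def P_def Q_def y_def sum_divide_distrib sum.distrib[symmetric] sum_distrib_left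
    by (intro sum.cong) (auto simp: power2_eq_square field_simps)
  have a4: "alpha4 q u l x y = \<beta> * (S - D) / 2 + (P - Q) / 2"
    unfolding alpha4_def S_def D_def P_def Q_def y_def sum_divide_distrib sum.distrib[symmetric]
      sum_subtractf[symmetric] sum_distrib_left
    by (intro sum.cong) (auto simp: power2_eq_square field_simps)
  have a2: "alpha2 q u l y = \<beta>\<^sup>2 * (S + D) / 2 + \<beta> * (P + Q) + (ES + ED) / 2"
    unfolding alpha2_def S_def D_def P_def Q_def ES_def ED_def y_def sum_divide_distrib sum.distrib[symmetric]
      sum_distrib_left
    by (intro sum.cong) (auto simp: power2_eq_square field_simps)
  have a6: "alpha6 q u l y = \<beta>\<^sup>2 * (S - D) / 4 + \<beta> * (P - Q) / 2 + (ES - ED) / 4"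
    unfolding alpha6_def S_def D_def P_def Q_def ES_def ED_def y_def sum_divide_distrib sum.distrib[symmetric]
      sum_subtractf[symmetric] sum_distrib_left
    by (intro sum.cong) (auto simp: power2_eq_square field_simps)
  show SD: "S + D = 2 * alpha1 q u l x" using a1' by simp
  from sol have b: "b = (p * alpha4 q u l x y - alpha3 q u l x y) / (2 * p * alpha5 q u l x - alpha1 q u l x)"
    and v: "v = (alpha2 q u l y + b\<^sup>2 * alpha1 q u l x - 2 * b * alpha3 q u l x y
            - 2 * p * alpha6 q u l y - 2 * p * b\<^sup>2 * alpha5 q u l x + 2 * p * b * alpha4 q u l x y)
         / (2 * real q * (1 - p\<^sup>2))"
    and p: "p = (alpha6 q u l y - b * alpha4 q u l x y + b\<^sup>2 * alpha5 q u l x) / (real q * v)"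
    and v0: "v > 0" and p1: "\<bar>p\<bar> < 1"
    unfolding bml_solution_def y_def by blast+
  have b': "b = t + \<beta>" by (simp add: t_def)
  define w where "w = real q * v"
  have w: "0 < w" using q v0 by (simp add: w_def)
  have pw: "4 * p * w = RS - RD"
  proof -
    have "p * w = alpha6 q u l y - b * alpha4 q u l x y + b\<^sup>2 * alpha5 q u l x"
      using p w by (metis less_irrefl nonzero_eq_divide_eq w_def)
    then show ?thesis unfolding a6 a4 a5 RS_def RD_def b'
      by (simp add: power2_eq_square field_simps)
  qed
  have p2: "p\<^sup>2 < 1" using p1 by (simp add: abs_square_less_1)
  have "w * (2 * (1 - p\<^sup>2)) = alpha2 q u l y + b\<^sup>2 * alpha1 q u l x - 2 * b * alpha3 q u l x y
            - 2 * p * alpha6 q u l y - 2 * p * b\<^sup>2 * alpha5 q u l x + 2 * p * b * alpha4 q u l x y"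
    using v p2 q by (simp add: w_def nonzero_eq_divide_eq mult_ac)
  \<comment> \<open>The second equation after rotation. Inserting \<open>pw\<close>, the third one,
    cancels the \<open>p\<^sup>2\<close> terms and leaves \<open>RS + RD = 4 * w\<close>.\<close>
  then have "4 * w * (1 - p\<^sup>2) = (1 - p) * RS + (1 + p) * RD"
    unfolding a1' a2 a3 a6 a4 a5 RS_def RD_def b'
    by (simp add: power2_eq_square field_simps)
  also have "\<dots> = (RS + RD) - p * (RS - RD)" by (simp add: algebra_simps)
  finally have "4 * w * (1 - p\<^sup>2) = RS + RD - p * (4 * p * w)" by (simp only: pw)
  then have "RS + RD = 4 * w" by (simp add: power2_eq_square algebra_simps)
  with pw have RS: "RS = 2 * w * (1 + p)" and RD: "RD = 2 * w * (1 - p)" by (simp_all add: algebra_simps)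
  show "0 < RS" "0 < RD" using RS RD w p1 by auto
  \<comment> \<open>The denominator of the first equation is minus one half of this sum, so the
    equation may be cleared of it.\<close>
  have "0 < (1 - p) * S + (1 + p) * D"
  proof -
    have "0 < S \<or> 0 < D" using a1 a1' S0 by (cases "0 < S") auto
    then show ?thesis using S0 p1 by (auto intro: add_pos_nonneg add_nonneg_pos)
  qed
  moreover have "2 * p * alpha5 q u l x - alpha1 q u l x = - ((1 - p) * S + (1 + p) * D) / 2"
    unfolding a5 a1' by (simp add: field_simps)
  ultimately have "b * (2 * p * alpha5 q u l x - alpha1 q u l x) = p * alpha4 q u l x y - alpha3 q u l x y"
    using b by simp
  then have "t * ((1 - p) * S + (1 + p) * D) = (1 - p) * P + (1 + p) * Q"
    unfolding a5 a1' a4 a3 b' by (simp add: field_simps)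
  \<comment> \<open>The factor \<open>2 * w\<close> turns the weights \<open>1 - p\<close> and
    \<open>1 + p\<close> into \<open>RD\<close> and \<open>RS\<close>.\<close>
  then have "2 * w * (t * ((1 - p) * S + (1 + p) * D)) = 2 * w * ((1 - p) * P + (1 + p) * Q)" by simp
  then show "t * (RD * S + RS * D) = RD * P + RS * Q"
    unfolding RS RD by (simp add: algebra_simps)
qed

text \<open>\<open>stationary_bound\<close> controls the error on the scale of the larger of
  \<open>S\<close> and \<open>D\<close>, which is at least \<open>alpha1\<close> because they add up
  to \<open>2 * alpha1\<close>. The stationary equation is symmetric under exchanging sums with
  differences, so the case \<open>S < D\<close> follows by swapping the roles.\<close>

lemma bml_error_bound:
  fixes q :: nat and x e :: "'s \<Rightarrow> real" and \<beta> c C K :: real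
  assumes sol: "bml_solution q u l x (\<lambda>s. \<beta> * x s + e s) b v p"
    and q: "q \<ge> 1" and a1: "0 < alpha1 q u l x" and c: "0 < c" and C: "0 < C"
    and K: "10 * K \<le> c * q"
    and P: "(\<Sum>i=1..q. (x (u i) + x (l i)) * (e (u i) + e (l i)))\<^sup>2
        \<le> K * (\<Sum>i=1..q. (x (u i) + x (l i))\<^sup>2)"
    and Q: "(\<Sum>i=1..q. (x (u i) - x (l i)) * (e (u i) - e (l i)))\<^sup>2
        \<le> K * (\<Sum>i=1..q. (x (u i) - x (l i))\<^sup>2)"
    and ES: "c * q \<le> (\<Sum>i=1..q. (e (u i) + e (l i))\<^sup>2)" "(\<Sum>i=1..q. (e (u i) + e (l i))\<^sup>2) \<le> C * q"
    and ED: "c * q \<le> (\<Sum>i=1..q. (e (u i) - e (l i))\<^sup>2)" "(\<Sum>i=1..q. (e (u i) - e (l i))\<^sup>2) \<le> C * q"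
  shows "(b - \<beta>)\<^sup>2 * alpha1 q u l x \<le> (1 + 4 * C / c)\<^sup>2 * K"
proof -
  define S D where "S = (\<Sum>i=1..q. (x (u i) + x (l i))\<^sup>2)" and "D = (\<Sum>i=1..q. (x (u i) - x (l i))\<^sup>2)"
  note sum_eqs = bml_solution_stationary[OF sol q a1, folded S_def D_def]
  have SD: "0 \<le> S" "0 \<le> D" unfolding S_def D_def by (auto intro: sum_nonneg)
  have n: "0 < real q" using q by simp
  have "\<exists>Z \<ge> alpha1 q u l x. (b - \<beta>)\<^sup>2 * Z \<le> (1 + 4 * C / c)\<^sup>2 * K"
  proof (cases "D \<le> S")
    case True
    then have S: "alpha1 q u l x \<le> S" "0 < S" using sum_eqs(4) a1 by auto
    have "(b - \<beta>)\<^sup>2 * S \<le> (1 + 4 * C / c)\<^sup>2 * K"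
      by (rule stationary_bound[OF SD(2) True S(2) P[folded S_def] Q[folded D_def] ES(2) ED(1)
            sum_eqs(1,2) n c C K refl refl sum_eqs(3)])
    then show ?thesis using S by blast
  next
    case False
    then have D: "alpha1 q u l x \<le> D" "0 < D" "S \<le> D" using sum_eqs(4) a1 by auto
    have "(b - \<beta>)\<^sup>2 * D \<le> (1 + 4 * C / c)\<^sup>2 * K"
      by (rule stationary_bound[OF SD(1) D(3,2) Q[folded D_def] P[folded S_def] ED(2) ES(1)
            sum_eqs(2,1) n c C K refl refl])
        (use sum_eqs(3) in \<open>simp add: add.commute\<close>)
    then show ?thesis using D by blast
  qed
  then show ?thesis
    by (meson mult_left_mono order_trans zero_le_power2)
qed

subsection \<open>Independent random variables\<close>

context prob_space
begin

text \<open>Induction on the index set: a new summand is independent of the partial sum, so the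
  mixed term has expectation zero.\<close>

lemma indep_vars_sum_square:
  fixes X :: "'i \<Rightarrow> 'a \<Rightarrow> real"
  assumes "finite I" "indep_vars (\<lambda>_. borel) X I"
    and "\<And>i. i \<in> I \<Longrightarrow> integrable M (\<lambda>\<omega>. (X i \<omega>)\<^sup>2)"
    and "\<And>i. i \<in> I \<Longrightarrow> expectation (X i) = 0"
  shows "integrable M (\<lambda>\<omega>. (\<Sum>i\<in>I. X i \<omega>)\<^sup>2)"
    and "expectation (\<lambda>\<omega>. (\<Sum>i\<in>I. X i \<omega>)\<^sup>2) = (\<Sum>i\<in>I. expectation (\<lambda>\<omega>. (X i \<omega>)\<^sup>2))"
proof -
  have "integrable M (\<lambda>\<omega>. (\<Sum>i\<in>I. X i \<omega>)\<^sup>2) \<and>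
    expectation (\<lambda>\<omega>. (\<Sum>i\<in>I. X i \<omega>)\<^sup>2) = (\<Sum>i\<in>I. expectation (\<lambda>\<omega>. (X i \<omega>)\<^sup>2))"
    using assms
  proof (induction rule: finite_induct)
    case (insert i I)
    define T where "T \<omega> = (\<Sum>i\<in>I. X i \<omega>)" for \<omega>
    have T: "integrable M (\<lambda>\<omega>. (T \<omega>)\<^sup>2)"
        "expectation (\<lambda>\<omega>. (T \<omega>)\<^sup>2) = (\<Sum>i\<in>I. expectation (\<lambda>\<omega>. (X i \<omega>)\<^sup>2))"
      using insert.IH insert.prems indep_vars_subset[OF insert.prems(1), of I]
      unfolding T_def by auto
    have X_meas: "random_variable borel (X j)" if "j \<in> insert i I" for j
      using insert.prems(1) that by (auto simp: indep_vars_def)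
    then have T_meas: "random_variable borel T"
      unfolding T_def[abs_def] by (intro borel_measurable_sum) auto
    have Xi: "integrable M (X i)"
      by (rule square_integrable_imp_integrable) (use insert.prems X_meas in simp_all)
    have iT: "integrable M T"
      by (rule square_integrable_imp_integrable) (fact T_meas T)+
    have ind: "indep_var borel (X i) borel T"
      unfolding T_def[abs_def] by (rule indep_vars_sum[OF insert.hyps insert.prems(1)])
    have XT: "integrable M (\<lambda>\<omega>. X i \<omega> * T \<omega>)"
      by (rule indep_var_integrable[OF ind Xi iT])
    have XT0: "expectation (\<lambda>\<omega>. X i \<omega> * T \<omega>) = 0"
      using indep_var_lebesgue_integral[OF ind Xi iT] insert.prems by simp
    have eq: "(\<lambda>\<omega>. (\<Sum>i\<in>insert i I. X i \<omega>)\<^sup>2) = (\<lambda>\<omega>. (X i \<omega>)\<^sup>2 + (T \<omega>)\<^sup>2 + 2 * (X i \<omega> * T \<omega>))"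
      using insert.hyps by (simp add: T_def power2_eq_square algebra_simps)
    show ?case
      unfolding eq using insert.hyps insert.prems(2)[of i] T XT XT0 by simp
  qed simp
  then show "integrable M (\<lambda>\<omega>. (\<Sum>i\<in>I. X i \<omega>)\<^sup>2)"
    "expectation (\<lambda>\<omega>. (\<Sum>i\<in>I. X i \<omega>)\<^sup>2) = (\<Sum>i\<in>I. expectation (\<lambda>\<omega>. (X i \<omega>)\<^sup>2))" by auto
qed

text \<open>Chebyshev's inequality normalized by the weights. The second moment is \<open>V\<close>
  times the sum of the squared weights, so the bound is the same for all regressors.\<close>

lemma prob_weighted_sum_square_gt:
  fixes X :: "'i \<Rightarrow> 'a \<Rightarrow> real" and w :: "'i \<Rightarrow> real"
  assumes fin: "finite I" "I \<noteq> {}" and ind: "indep_vars (\<lambda>_. borel) X I"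
    and sq: "\<And>i. i \<in> I \<Longrightarrow> integrable M (\<lambda>\<omega>. (X i \<omega>)\<^sup>2)"
    and mean: "\<And>i. i \<in> I \<Longrightarrow> expectation (X i) = 0"
    and var: "\<And>i. i \<in> I \<Longrightarrow> expectation (\<lambda>\<omega>. (X i \<omega>)\<^sup>2) = V"
    and K: "0 < K"
  shows "prob {\<omega> \<in> space M. K * (\<Sum>i\<in>I. (w i)\<^sup>2) < (\<Sum>i\<in>I. w i * X i \<omega>)\<^sup>2} \<le> V / K"
proof (cases "(\<Sum>i\<in>I. (w i)\<^sup>2) = 0")
  \<comment> \<open>When all weights vanish the normalization degenerates, but the strict inequality
    makes the event empty and \<open>V \<ge> 0\<close> gives the bound.\<close>
  case True
  then have "w i = 0" if "i \<in> I" for i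
    using that fin by (simp add: sum_nonneg_eq_0_iff)
  moreover have "0 \<le> V" if "i \<in> I" for i
    using var[OF that, symmetric] by simp
  ultimately show ?thesis using True
    using fin K by auto
next
  case False
  define s where "s = (\<Sum>i\<in>I. (w i)\<^sup>2)"
  have s: "0 < s" using False sum_nonneg[of I "\<lambda>i. (w i)\<^sup>2"] by (simp add: s_def)
  have meas[measurable]: "random_variable borel (X i)" if "i \<in> I" for i
    using ind that by (auto simp: indep_vars_def)
  have ind': "indep_vars (\<lambda>_. borel) (\<lambda>i \<omega>. w i * X i \<omega>) I"
    by (rule indep_vars_compose2[OF ind]) measurable
  have "integrable M (\<lambda>\<omega>. (\<Sum>i\<in>I. w i * X i \<omega>)\<^sup>2)"
    and "expectation (\<lambda>\<omega>. (\<Sum>i\<in>I. w i * X i \<omega>)\<^sup>2) = (\<Sum>i\<in>I. expectation (\<lambda>\<omega>. (w i * X i \<omega>)\<^sup>2))"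
    using indep_vars_sum_square[OF fin(1) ind'] sq mean by (auto simp: power_mult_distrib)
  moreover have "(\<Sum>i\<in>I. expectation (\<lambda>\<omega>. (w i * X i \<omega>)\<^sup>2)) = V * s"
    using sq var by (simp add: power_mult_distrib s_def sum_distrib_left mult.commute)
  ultimately have "prob {\<omega> \<in> space M. K * s \<le> (\<Sum>i\<in>I. w i * X i \<omega>)\<^sup>2} \<le> V * s / (K * s)"
    using integral_Markov_inequality_measure[of M "\<lambda>\<omega>. (\<Sum>i\<in>I. w i * X i \<omega>)\<^sup>2" "{}" "K * s"] K s
    by simp
  moreover have "prob {\<omega> \<in> space M. K * s < (\<Sum>i\<in>I. w i * X i \<omega>)\<^sup>2}
      \<le> prob {\<omega> \<in> space M. K * s \<le> (\<Sum>i\<in>I. w i * X i \<omega>)\<^sup>2}"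
    by (intro finite_measure_mono) auto
  ultimately show ?thesis using s by (simp add: s_def)
qed

lemma prob_sum_squares_gt:
  fixes X :: "'i \<Rightarrow> 'a \<Rightarrow> real" and C :: real
  assumes fin: "finite I" "I \<noteq> {}"
    and meas[measurable]: "\<And>i. i \<in> I \<Longrightarrow> random_variable borel (X i)"
    and sq: "\<And>i. i \<in> I \<Longrightarrow> integrable M (\<lambda>\<omega>. (X i \<omega>)\<^sup>2)"
    and var: "\<And>i. i \<in> I \<Longrightarrow> expectation (\<lambda>\<omega>. (X i \<omega>)\<^sup>2) = V"
    and C: "0 < C"
  shows "prob {\<omega> \<in> space M. C * card I < (\<Sum>i\<in>I. (X i \<omega>)\<^sup>2)} \<le> V / C"
proof -
  have n: "0 < real (card I)" using fin by (simp add: card_gt_0_iff)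
  have "prob {\<omega> \<in> space M. C * card I < (\<Sum>i\<in>I. (X i \<omega>)\<^sup>2)}
      \<le> prob {\<omega> \<in> space M. C * card I \<le> (\<Sum>i\<in>I. (X i \<omega>)\<^sup>2)}"
    by (intro finite_measure_mono) auto
  also have "\<dots> \<le> expectation (\<lambda>\<omega>. \<Sum>i\<in>I. (X i \<omega>)\<^sup>2) / (C * card I)"
    using sq C n by (intro integral_Markov_inequality_measure[where A = "{}"]) (auto intro!: AE_I2 sum_nonneg)
  also have "\<dots> = V / C"
    using sq var n by (simp add: Bochner_Integration.integral_sum)
  finally show ?thesis .
qed

text \<open>Chernoff's method with exponent -1: Markov's inequality for the exponential of minus the
  sum, whose expectation factors by independence. The bound decays geometrically once
  \<open>exp c * m < 1\<close>.\<close>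

lemma prob_sum_squares_less:
  fixes X :: "'i \<Rightarrow> 'a \<Rightarrow> real" and c :: real
  assumes fin: "finite I" and ind: "indep_vars (\<lambda>_. borel) X I"
    and m: "\<And>i. i \<in> I \<Longrightarrow> expectation (\<lambda>\<omega>. exp (- (X i \<omega>)\<^sup>2)) = m"
  shows "prob {\<omega> \<in> space M. (\<Sum>i\<in>I. (X i \<omega>)\<^sup>2) < c * card I} \<le> (exp c * m) ^ card I"
proof -
  have meas[measurable]: "random_variable borel (X i)" if "i \<in> I" for i
    using ind that by (auto simp: indep_vars_def)
  have ind': "indep_vars (\<lambda>_. borel) (\<lambda>i \<omega>. exp (- (X i \<omega>)\<^sup>2)) I"
    by (rule indep_vars_compose2[OF ind]) measurable
  have int: "integrable M (\<lambda>\<omega>. exp (- (X i \<omega>)\<^sup>2))" if "i \<in> I" for i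
    using that by (intro integrable_const_bound[where B = 1]) auto
  have "prob {\<omega> \<in> space M. (\<Sum>i\<in>I. (X i \<omega>)\<^sup>2) < c * card I}
      \<le> prob {\<omega> \<in> space M. exp (- (c * card I)) \<le> (\<Prod>i\<in>I. exp (- (X i \<omega>)\<^sup>2))}"
    by (intro finite_measure_mono) (auto simp: exp_sum[symmetric] fin sum_negf)
  also have "\<dots> \<le> expectation (\<lambda>\<omega>. \<Prod>i\<in>I. exp (- (X i \<omega>)\<^sup>2)) / exp (- (c * card I))"
    using indep_vars_integrable[OF fin ind' int]
    by (intro integral_Markov_inequality_measure[where A = "{}"]) (auto intro!: AE_I2 prod_nonneg)
  also have "\<dots> = m ^ card I * exp (c * card I)"
    using indep_vars_lebesgue_integral[OF fin ind' int] m by (simp add: exp_minus field_simps)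
  also have "\<dots> = (exp c * m) ^ card I"
    by (simp add: power_mult_distrib exp_of_nat_mult[symmetric] mult.commute)
  finally show ?thesis .
qed

end

subsection \<open>Linear forms of bivariate normal pairs\<close>

lemma integrable_gaussian_pair:
  fixes k :: real
  assumes "0 < k"
  shows "integrable lborel (\<lambda>z::real \<times> real. exp (- k * (norm z)\<^sup>2))"
proof -
  \<comment> \<open>The standard deviation for which the normal density has exponent
    \<open>- k * a\<^sup>2\<close>.\<close>
  define s where "s = sqrt (1 / (2 * k))"
  have s: "0 < s" "2 * s\<^sup>2 = 1 / k" using assms by (auto simp: s_def)
  have "(\<lambda>a. exp (- k * a\<^sup>2)) = (\<lambda>a. sqrt (2 * pi * s\<^sup>2) * normal_density 0 s a)"
  proof
    fix a
    have "a\<^sup>2 / (2 * s\<^sup>2) = k * a\<^sup>2" using assms by (simp add: s)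
    then show "exp (- k * a\<^sup>2) = sqrt (2 * pi * s\<^sup>2) * normal_density 0 s a"
      using s by (simp add: normal_density_def)
  qed
  then have 1: "integrable lborel (\<lambda>a. exp (- k * a\<^sup>2))"
    using s by simp
  have "integrable (lborel \<Otimes>\<^sub>M lborel) (\<lambda>(a, b). exp (- k * a\<^sup>2) * exp (- k * b\<^sup>2) :: real)"
    using 1 by (intro lborel_pair.Fubini_integrable) auto
  then have "integrable lborel (\<lambda>(a, b). exp (- k * a\<^sup>2) * exp (- k * b\<^sup>2) :: real)"
    by (simp add: lborel_prod)
  then show ?thesis
    by (rule Bochner_Integration.integrable_cong[THEN iffD1, rotated -1])
      (auto simp: norm_Pair exp_add[symmetric] algebra_simps)
qed

lemma bivariate_normal_density_nonneg:
  "\<bar>\<psi>\<bar> < 1 \<Longrightarrow> 0 < v \<Longrightarrow> 0 \<le> bivariate_normal_density v \<psi> z"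
  by (auto simp: bivariate_normal_density_def split_beta abs_square_less_1 less_imp_le)

lemma bivariate_normal_density_measurable[measurable]:
  "bivariate_normal_density v \<psi> \<in> borel_measurable borel"
  unfolding bivariate_normal_density_def borel_prod[symmetric] by measurable

lemma bivariate_normal_density_uminus:
  "bivariate_normal_density v \<psi> (- z) = bivariate_normal_density v \<psi> z"
  by (cases z) (simp add: bivariate_normal_density_def)

text \<open>The quadratic form in the exponent is at least \<open>1 - \<bar>\<psi>\<bar>\<close>,
  its smaller eigenvalue, times the squared norm. So the density lies below a multiple of an
  isotropic Gaussian, against which quadratic growth is integrable.\<close>

lemma integrable_bivariate_normal_square:
  fixes w :: "real \<times> real"
  assumes v: "0 < v" and \<psi>: "\<bar>\<psi>\<bar> < 1"
  shows "integrable lborel (\<lambda>z. bivariate_normal_density v \<psi> z * (w \<bullet> z)\<^sup>2)"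
proof -
  define k where "k = (1 - \<bar>\<psi>\<bar>) / (2 * v * (1 - \<psi>\<^sup>2))"
  have \<psi>2: "0 < 1 - \<psi>\<^sup>2" using \<psi> by (simp add: abs_square_less_1)
  have k: "0 < k" using \<psi> \<psi>2 v by (simp add: k_def)
  define B where "B = 1 / (2 * pi * v * sqrt (1 - \<psi>\<^sup>2))"
  have B: "0 \<le> B" using \<psi>2 v by (simp add: B_def)
  have dens: "bivariate_normal_density v \<psi> z \<le> B * exp (- k * (norm z)\<^sup>2)" for z
  proof (cases z)
    case (Pair a b)
    have "2 * \<psi> * a * b \<le> \<bar>\<psi>\<bar> * (2 * (\<bar>a\<bar> * \<bar>b\<bar>))"
      using abs_ge_self[of "\<psi> * (a * b)"] by (simp add: abs_mult)
    also have "\<dots> \<le> \<bar>\<psi>\<bar> * (a\<^sup>2 + b\<^sup>2)"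
      using sum_squares_bound[of "\<bar>a\<bar>" "\<bar>b\<bar>"] by (intro mult_left_mono) (auto simp: mult_ac)
    finally have "(1 - \<bar>\<psi>\<bar>) * (a\<^sup>2 + b\<^sup>2) \<le> a\<^sup>2 - 2 * \<psi> * a * b + b\<^sup>2"
      by (simp add: algebra_simps)
    then have "(1 - \<bar>\<psi>\<bar>) * (a\<^sup>2 + b\<^sup>2) / (2 * v * (1 - \<psi>\<^sup>2)) \<le> (a\<^sup>2 - 2 * \<psi> * a * b + b\<^sup>2) / (2 * v * (1 - \<psi>\<^sup>2))"
      using v \<psi>2 by (intro divide_right_mono) auto
    moreover have "(1 - \<bar>\<psi>\<bar>) * (a\<^sup>2 + b\<^sup>2) / (2 * v * (1 - \<psi>\<^sup>2)) = k * (norm z)\<^sup>2"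
      by (simp add: k_def Pair norm_Pair)
    ultimately have "- (a\<^sup>2 - 2 * \<psi> * a * b + b\<^sup>2) / (2 * v * (1 - \<psi>\<^sup>2)) \<le> - k * (norm z)\<^sup>2"
      unfolding minus_divide_left[symmetric] by linarith
    then show ?thesis
      unfolding Pair bivariate_normal_density_def B_def[symmetric] using B
      by (simp add: mult_left_mono)
  qed
  \<comment> \<open>Half of the exponent pays for the factor \<open>u\<close>.\<close>
  have bnd: "u * exp (- k * u) \<le> 2 / k * exp (- (k / 2) * u)" for u :: real
  proof -
    have "k / 2 * u \<le> exp (k / 2 * u)" using exp_ge_add_one_self[of "k / 2 * u"] by linarith
    then have "u \<le> 2 / k * exp (k / 2 * u)" using k by (simp add: field_simps)
    then have "u * exp (- k * u) \<le> 2 / k * exp (k / 2 * u) * exp (- k * u)" by (intro mult_right_mono) auto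
    also have "\<dots> = 2 / k * exp (- (k / 2) * u)" by (simp add: exp_add[symmetric] mult.assoc)
    finally show ?thesis .
  qed
  have "integrable lborel (\<lambda>z::real \<times> real. (B * (norm w)\<^sup>2 * (2 / k)) * exp (- (k / 2) * (norm z)\<^sup>2))"
    using integrable_gaussian_pair[of "k / 2"] k by (intro integrable_mult_right) auto
  then show ?thesis
  proof (rule Bochner_Integration.integrable_bound)
    show "AE z in lborel. norm (bivariate_normal_density v \<psi> z * (w \<bullet> z)\<^sup>2)
        \<le> norm (B * (norm w)\<^sup>2 * (2 / k) * exp (- (k / 2) * (norm z)\<^sup>2))"
    proof (rule AE_I2)
      fix z
      have "(w \<bullet> z)\<^sup>2 \<le> (norm w * norm z)\<^sup>2"
        using Cauchy_Schwarz_ineq2[of w z] by (metis abs_ge_zero power2_abs power_mono)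
      then have "bivariate_normal_density v \<psi> z * (w \<bullet> z)\<^sup>2
          \<le> (B * exp (- k * (norm z)\<^sup>2)) * (norm w * norm z)\<^sup>2"
        using B dens bivariate_normal_density_nonneg[OF \<psi> v] by (intro mult_mono) auto
      also have "\<dots> = (B * (norm w)\<^sup>2) * ((norm z)\<^sup>2 * exp (- k * (norm z)\<^sup>2))"
        by (simp add: power_mult_distrib)
      also have "\<dots> \<le> (B * (norm w)\<^sup>2) * (2 / k * exp (- (k / 2) * (norm z)\<^sup>2))"
        using B by (intro mult_left_mono bnd) auto
      finally show "norm (bivariate_normal_density v \<psi> z * (w \<bullet> z)\<^sup>2)
        \<le> norm (B * (norm w)\<^sup>2 * (2 / k) * exp (- (k / 2) * (norm z)\<^sup>2))"
        using B k bivariate_normal_density_nonneg[OF \<psi> v, of z] by (simp add: mult.assoc)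
    qed
  qed measurable
qed

text \<open>Reflection preserves Lebesgue measure, so the integral equals its own negative. For
  non-integrable \<open>f\<close> this agrees with the convention that the integral is 0.\<close>

lemma integral_odd_eq_0:
  fixes f :: "'a::euclidean_space \<Rightarrow> real"
  assumes [measurable]: "f \<in> borel_measurable borel" and odd: "\<And>z. f (- z) = - f z"
  shows "integral\<^sup>L lborel f = 0"
proof -
  have "distr lborel borel (\<lambda>x::'a. - x) = lborel"
    using lborel_affine[of "-1" "0::'a"] by (simp add: density_1)
  then have "integral\<^sup>L lborel f = integral\<^sup>L (distr lborel borel (\<lambda>x::'a. - x)) f" by simp
  also have "\<dots> = (\<integral>z. f (- z) \<partial>lborel)" by (intro integral_distr) auto
  also have "\<dots> = - integral\<^sup>L lborel f" by (simp add: odd)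
  finally show ?thesis by simp
qed

lemma AE_lborel_not_hyperplane:
  fixes w :: "'a::euclidean_space"
  assumes "w \<noteq> 0"
  shows "AE z in lborel. w \<bullet> z \<noteq> 0"
proof -
  have "{z. w \<bullet> z = 0} \<in> null_sets lborel"
    using negligible_hyperplane[of w 0] assms
    by (simp add: negligible_iff_null_sets null_sets_completion_iff)
  then show ?thesis by (rule AE_I') auto
qed

text \<open>\<open>V\<close> and \<open>m\<close> are integrals against the density and therefore
  common to all pairs. The linear form vanishes only on a null hyperplane; this gives
  \<open>m < 1\<close>, which makes the Chernoff bound effective.\<close>

lemma bivariate_normal_linear_form:
  fixes w :: "real \<times> real"
  assumes v: "0 < v" and \<psi>: "\<bar>\<psi>\<bar> < 1" and w: "w \<noteq> 0"
    and ex: "prob_space M" "distributed M lborel Z (\<lambda>z. ennreal (bivariate_normal_density v \<psi> z))"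
  defines "V \<equiv> \<integral>z. bivariate_normal_density v \<psi> z * (w \<bullet> z)\<^sup>2 \<partial>lborel"
    and "m \<equiv> \<integral>z. bivariate_normal_density v \<psi> z * exp (- (w \<bullet> z)\<^sup>2) \<partial>lborel"
  shows "integrable M (\<lambda>\<omega>. (w \<bullet> Z \<omega>)\<^sup>2)" "(\<integral>\<omega>. w \<bullet> Z \<omega> \<partial>M) = 0"
    "(\<integral>\<omega>. (w \<bullet> Z \<omega>)\<^sup>2 \<partial>M) = V" "(\<integral>\<omega>. exp (- (w \<bullet> Z \<omega>)\<^sup>2) \<partial>M) = m" "0 < m" "m < 1"
proof -
  interpret prob_space M by fact
  note nn = bivariate_normal_density_nonneg[OF \<psi> v]
  note I = distributed_integral[OF ex(2) _ nn]
  have Z[measurable]: "random_variable borel Z"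
    using distributed_measurable[OF ex(2)] by simp
  show "integrable M (\<lambda>\<omega>. (w \<bullet> Z \<omega>)\<^sup>2)"
    using distributed_integrable[OF ex(2) _ nn, of "\<lambda>z. (w \<bullet> z)\<^sup>2"]
      integrable_bivariate_normal_square[OF v \<psi>] by simp
  show "(\<integral>\<omega>. w \<bullet> Z \<omega> \<partial>M) = 0"
    using I[of "\<lambda>z. w \<bullet> z"]
      integral_odd_eq_0[of "\<lambda>z. bivariate_normal_density v \<psi> z * (w \<bullet> z)"]
    by (simp add: bivariate_normal_density_uminus)
  show "(\<integral>\<omega>. (w \<bullet> Z \<omega>)\<^sup>2 \<partial>M) = V"
    using I[of "\<lambda>z. (w \<bullet> z)\<^sup>2"] by (simp add: V_def)
  show m: "(\<integral>\<omega>. exp (- (w \<bullet> Z \<omega>)\<^sup>2) \<partial>M) = m"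
    using I[of "\<lambda>z. exp (- (w \<bullet> z)\<^sup>2)"] by (simp add: m_def)
  have int: "integrable M (\<lambda>\<omega>. exp (- (w \<bullet> Z \<omega>)\<^sup>2))"
    by (intro integrable_const_bound[where B = 1]) auto
  have "(\<integral>\<omega>. 0 \<partial>M) < (\<integral>\<omega>. exp (- (w \<bullet> Z \<omega>)\<^sup>2) \<partial>M)"
    by (intro integral_less_AE_space int) (auto simp: emeasure_space_1)
  then show "0 < m" using m by simp
  have "AE z in density lborel (\<lambda>z. ennreal (bivariate_normal_density v \<psi> z)). w \<bullet> z \<noteq> 0"
    using AE_lborel_not_hyperplane[OF w] by (subst AE_density) auto
  then have "AE z in distr M lborel Z. w \<bullet> z \<noteq> 0"
    unfolding distributed_distr_eq_density[OF ex(2)] .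
  then have "AE \<omega> in M. w \<bullet> Z \<omega> \<noteq> 0"
    by (subst (asm) AE_distr_iff) auto
  then have "(\<integral>\<omega>. exp (- (w \<bullet> Z \<omega>)\<^sup>2) \<partial>M) < (\<integral>\<omega>. 1 \<partial>M)"
    by (intro integral_less_AE_space int) (auto simp: emeasure_space_1)
  then show "m < 1" using m by (simp add: prob_space)
qed

text \<open>\<open>r = 1\<close> gives the sums and \<open>r = - 1\<close> the differences within
  pairs. \<open>B\<close> collects the failures of the three bounds that
  \<open>bml_error_bound\<close> requires of one regression, with \<open>K\<close> also as the upper
  constant. \<open>V\<close> and \<open>m\<close> do not depend on \<open>q\<close> or on the
  coding.\<close>

lemma pairwise_gaussian_errors_bounds:
  fixes r c :: real and a :: "nat \<Rightarrow> real"
  assumes v: "0 < v" and \<psi>: "\<bar>\<psi>\<bar> < 1" and M: "prob_space M" and q: "q \<ge> 1" and K: "0 < K"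
    and err: "pairwise_gaussian_errors M q u l \<epsilon> v \<psi>"
  defines "V \<equiv> \<integral>z. bivariate_normal_density v \<psi> z * ((1, r) \<bullet> z)\<^sup>2 \<partial>lborel"
    and "m \<equiv> \<integral>z. bivariate_normal_density v \<psi> z * exp (- ((1, r) \<bullet> z)\<^sup>2) \<partial>lborel"
    and "X \<equiv> \<lambda>i \<omega>. \<epsilon> (u i) \<omega> + r * \<epsilon> (l i) \<omega>"
  defines "B \<equiv> {\<omega> \<in> space M. K * (\<Sum>i=1..q. (a i)\<^sup>2) < (\<Sum>i=1..q. a i * X i \<omega>)\<^sup>2}
      \<union> {\<omega> \<in> space M. K * q < (\<Sum>i=1..q. (X i \<omega>)\<^sup>2)}
      \<union> {\<omega> \<in> space M. (\<Sum>i=1..q. (X i \<omega>)\<^sup>2) < c * q}"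
  shows "B \<in> sets M" "measure M B \<le> 2 * (V / K) + (exp c * m) ^ q"
    "0 \<le> V" "0 < m" "m < 1"
proof -
  interpret prob_space M by fact
  have X: "X i \<omega> = (1, r) \<bullet> (\<epsilon> (u i) \<omega>, \<epsilon> (l i) \<omega>)" for i \<omega>
    by (simp add: X_def inner_Pair)
  have ind0: "indep_vars (\<lambda>_. borel) (\<lambda>i \<omega>. (\<epsilon> (u i) \<omega>, \<epsilon> (l i) \<omega>)) {1..q}"
    and dist: "\<And>i. i \<in> {1..q} \<Longrightarrow> distributed M lborel (\<lambda>\<omega>. (\<epsilon> (u i) \<omega>, \<epsilon> (l i) \<omega>))
                    (\<lambda>z. ennreal (bivariate_normal_density v \<psi> z))"
    using err unfolding pairwise_gaussian_errors_def by auto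
  have ind: "indep_vars (\<lambda>_. borel) X {1..q}"
    unfolding X by (rule indep_vars_compose2[OF ind0]) auto
  have w: "(1, r) \<noteq> (0 :: real \<times> real)" by (simp add: zero_prod_def)
  note form = bivariate_normal_linear_form[OF v \<psi> w M dist, folded X V_def m_def]
  have meas[measurable]: "random_variable borel (X i)" if "i \<in> {1..q}" for i
    using ind that by (auto simp: indep_vars_def)
  have 1: "1 \<in> {1..q}" using q by simp
  show "0 < m" "m < 1" using form(5,6)[OF 1] by auto
  show "0 \<le> V" using form(3)[OF 1, symmetric] by simp
  show "B \<in> sets M" unfolding B_def by measurable
  have I: "finite {1..q}" "{1..q} \<noteq> {}" using q by auto
  have "measure M B \<le> V / K + V / K + (exp c * m) ^ q"
    unfolding B_def
    by (intro measure_Un_le[THEN order_trans] add_mono)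
      (use prob_weighted_sum_square_gt[OF I ind form(1,2,3) K, of a]
         prob_sum_squares_gt[OF I meas form(1,3) K]
         prob_sum_squares_less[OF I(1) ind form(4), of c] in \<open>simp_all\<close>)
  then show "measure M B \<le> 2 * (V / K) + (exp c * m) ^ q" by simp
qed

section \<open>Convergence in probability of the BML estimator\<close>

theorem theorem5:
  fixes M :: "'a measure"
    and N :: "('s \<times> 's) set"
    and u l :: "nat \<Rightarrow> nat \<Rightarrow> 's"
    and x :: "'s \<Rightarrow> real"
    and y \<epsilon> :: "'s \<Rightarrow> 'a \<Rightarrow> real"
    and \<beta> \<sigma> \<psi> :: real
    and beta_hat sigma2_hat psi_hat :: "nat \<Rightarrow> 'a \<Rightarrow> real"
  assumes "prob_space M"
    and "\<sigma>\<^sup>2 > 0" and "\<bar>\<psi>\<bar> < 1"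
    and model: "\<And>s \<omega>. \<omega> \<in> space M \<Longrightarrow> y s \<omega> = \<beta> * x s + \<epsilon> s \<omega>"
    and coding: "\<And>q. q \<ge> 1 \<Longrightarrow> bivariate_coding N q (u q) (l q)"
    and errors: "\<And>q. q \<ge> 1 \<Longrightarrow> pairwise_gaussian_errors M q (u q) (l q) \<epsilon> (\<sigma>\<^sup>2) \<psi>"
    and growth: "filterlim (\<lambda>q. alpha1 q (u q) (l q) x) at_top sequentially"
    and estimator_measurable: "\<And>q. beta_hat q \<in> borel_measurable M"
    and estimator: "\<forall>\<^sub>F q in sequentially. AE \<omega> in M.
          bml_solution q (u q) (l q) x (\<lambda>s. y s \<omega>) (beta_hat q \<omega>) (sigma2_hat q \<omega>) (psi_hat q \<omega>)"
  shows "weakly_consistent M beta_hat \<beta>"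
proof -
  interpret prob_space M by fact
  note bounds = pairwise_gaussian_errors_bounds[OF assms(2,3) \<open>prob_space M\<close> _ _ errors]
  define V where "V r = (\<integral>z. bivariate_normal_density (\<sigma>\<^sup>2) \<psi> z * ((1, r) \<bullet> z)\<^sup>2 \<partial>lborel)" for r
  define m where "m r = (\<integral>z. bivariate_normal_density (\<sigma>\<^sup>2) \<psi> z * exp (- ((1, r) \<bullet> z)\<^sup>2) \<partial>lborel)" for r
  \<comment> \<open>These facts concern the density alone, so they are read off the coding with a
    single pair and \<open>K = 1\<close>.\<close>
  have V: "0 \<le> V r" and m: "0 < m r" "m r < 1" for r
    using bounds(3-5)[OF order_refl zero_less_one order_refl, where r = r] by (simp_all add: V_def m_def)
  define W where "W = max (V 1) (V (- 1)) + 1"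
  have W: "V 1 \<le> W" "V (- 1) \<le> W" "0 < W" using V[of 1] by (auto simp: W_def)
  define \<mu> where "\<mu> = max (m 1) (m (- 1))"
  have \<mu>: "m 1 \<le> \<mu>" "m (- 1) \<le> \<mu>" "0 < \<mu>" "\<mu> < 1"
    using m[of 1] m[of "- 1"] by (auto simp: \<mu>_def)
  \<comment> \<open>With this choice \<open>exp c * \<mu>\<close> equals \<open>exp (- c)\<close>,
    the square root of \<open>\<mu>\<close>, so the lower deviations have geometrically small
    probability.\<close>
  define c where "c = - ln \<mu> / 2"
  have c: "0 < c" using \<mu> by (simp add: c_def)
  define \<rho> where "\<rho> = exp c * \<mu>"
  have "\<rho> = exp (c + ln \<mu>)" using \<mu> by (simp add: \<rho>_def exp_add)
  also have "c + ln \<mu> = - c" by (simp add: c_def)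
  finally have \<rho>: "0 < \<rho>" "\<rho> < 1" using c by auto
  show ?thesis
    unfolding weakly_consistent_def
  proof (intro allI impI tendstoI)
    fix e \<eta> :: real
    assume e: "0 < e" and \<eta>: "0 < \<eta>"
    \<comment> \<open>The first two events of each \<open>B r\<close> cost at most
      \<open>2 * (W / K)\<close>, in total \<open>\<eta> / 2\<close> for \<open>r = 1\<close> and
      \<open>r = - 1\<close>. The other half of \<open>\<eta>\<close> is left for the two geometric
      terms.\<close>
    define K where "K = 8 * W / \<eta>"
    have K: "0 < K" using W \<eta> by (simp add: K_def)
    have "(\<lambda>q. 2 * \<rho> ^ q) \<longlonglongrightarrow> 2 * 0"
      using \<rho> by (intro tendsto_intros LIMSEQ_power_zero) auto
    then have ev1: "\<forall>\<^sub>F q in sequentially. 2 * \<rho> ^ q < \<eta> / 2"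
      by (rule order_tendstoD(2)) (use \<eta> in simp)
    have ev2: "\<forall>\<^sub>F q in sequentially. 10 * K \<le> c * real q"
    proof -
      have "filterlim (\<lambda>q. c * real q) at_top sequentially"
        using c by (intro filterlim_tendsto_pos_mult_at_top[OF tendsto_const] filterlim_real_sequentially)
      then show ?thesis by (simp add: filterlim_at_top)
    qed
    \<comment> \<open>The threshold is the bound of \<open>bml_error_bound\<close>, with
      \<open>K\<close> also in the role of \<open>C\<close>, divided by \<open>e\<^sup>2\<close>:
      beyond it an error larger than \<open>e\<close> contradicts that bound.\<close>
    have ev3: "\<forall>\<^sub>F q in sequentially. (1 + 4 * K / c)\<^sup>2 * K / e\<^sup>2 < alpha1 q (u q) (l q) x"
      using growth unfolding filterlim_at_top_dense by blast
    show "\<forall>\<^sub>F q in sequentially. dist (measure M {\<omega> \<in> space M. \<bar>beta_hat q \<omega> - \<beta>\<bar> > e}) 0 < \<eta>"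
      using ev1 ev2 ev3 estimator eventually_ge_at_top[of 1]
    proof eventually_elim
      case (elim q)
      define X where "X r i \<omega> = \<epsilon> (u q i) \<omega> + r * \<epsilon> (l q i) \<omega>" for r i \<omega>
      define a where "a r i = x (u q i) + r * x (l q i)" for r i
      define B where "B r = {\<omega> \<in> space M. K * (\<Sum>i=1..q. (a r i)\<^sup>2) < (\<Sum>i=1..q. a r i * X r i \<omega>)\<^sup>2}
        \<union> {\<omega> \<in> space M. K * q < (\<Sum>i=1..q. (X r i \<omega>)\<^sup>2)}
        \<union> {\<omega> \<in> space M. (\<Sum>i=1..q. (X r i \<omega>)\<^sup>2) < c * q}" for r
      have B: "B r \<in> sets M" "prob (B r) \<le> 2 * (V r / K) + (exp c * m r) ^ q" for r
        using bounds(1,2)[OF \<open>1 \<le> q\<close> K \<open>1 \<le> q\<close>, where r = r and a = "a r" and c = c]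
        by (simp_all add: B_def X_def V_def m_def)
      have pB: "prob (B r) \<le> 2 * (W / K) + \<rho> ^ q" if "V r \<le> W" "m r \<le> \<mu>" for r
      proof -
        have "V r / K \<le> W / K" using that K by (intro divide_right_mono) auto
        moreover have "(exp c * m r) ^ q \<le> \<rho> ^ q"
          unfolding \<rho>_def using that m(1)[of r] by (simp add: power_mono)
        ultimately show ?thesis using B(2)[of r] by linarith
      qed
      \<comment> \<open>The inclusion is deterministic wherever the system holds: off both
        exceptional events the error bound applies to whichever solution the estimator selects. The
        remaining sample points form a null set.\<close>
      have "AE \<omega> in M. \<omega> \<in> {\<omega> \<in> space M. \<bar>beta_hat q \<omega> - \<beta>\<bar> > e} \<longrightarrow> \<omega> \<in> B 1 \<union> B (- 1)"
        using elim(4)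
      proof (rule AE_mp, intro AE_I2 impI)
        fix \<omega>
        assume \<omega>: "\<omega> \<in> space M"
          and sol: "bml_solution q (u q) (l q) x (\<lambda>s. y s \<omega>) (beta_hat q \<omega>) (sigma2_hat q \<omega>) (psi_hat q \<omega>)"
          and far: "\<omega> \<in> {\<omega> \<in> space M. \<bar>beta_hat q \<omega> - \<beta>\<bar> > e}"
        show "\<omega> \<in> B 1 \<union> B (- 1)"
        proof (rule ccontr)
          assume "\<omega> \<notin> B 1 \<union> B (- 1)"
          then have good:
            "(\<Sum>i=1..q. a r i * X r i \<omega>)\<^sup>2 \<le> K * (\<Sum>i=1..q. (a r i)\<^sup>2)"
            "c * q \<le> (\<Sum>i=1..q. (X r i \<omega>)\<^sup>2)" "(\<Sum>i=1..q. (X r i \<omega>)\<^sup>2) \<le> K * q" if "r \<in> {1, - 1}" for r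
            using \<open>\<omega> \<notin> B 1 \<union> B (- 1)\<close> \<omega> that unfolding B_def by force+
          have a1: "0 < alpha1 q (u q) (l q) x"
            by (rule le_less_trans[OF _ elim(3)]) (use K in simp)
          have sol': "bml_solution q (u q) (l q) x (\<lambda>s. \<beta> * x s + \<epsilon> s \<omega>)
              (beta_hat q \<omega>) (sigma2_hat q \<omega>) (psi_hat q \<omega>)"
            using sol by (simp add: model[OF \<omega>])
          have "(beta_hat q \<omega> - \<beta>)\<^sup>2 * alpha1 q (u q) (l q) x \<le> (1 + 4 * K / c)\<^sup>2 * K"
            by (rule bml_error_bound[OF sol' \<open>1 \<le> q\<close> a1 c K elim(2)])
              (use good[of 1] good[of "- 1"] in \<open>simp_all add: a_def X_def\<close>)
          moreover have "(1 + 4 * K / c)\<^sup>2 * K < e\<^sup>2 * alpha1 q (u q) (l q) x"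
            using elim(3) e by (simp add: field_simps)
          moreover have "e\<^sup>2 * alpha1 q (u q) (l q) x \<le> (beta_hat q \<omega> - \<beta>)\<^sup>2 * alpha1 q (u q) (l q) x"
          proof (rule mult_right_mono)
            show "e\<^sup>2 \<le> (beta_hat q \<omega> - \<beta>)\<^sup>2"
              using far e by (subst abs_le_square_iff[symmetric]) auto
          qed (use a1 in simp)
          ultimately show False by linarith
        qed
      qed
      then have "prob {\<omega> \<in> space M. \<bar>beta_hat q \<omega> - \<beta>\<bar> > e} \<le> prob (B 1 \<union> B (- 1))"
        by (rule finite_measure_mono_AE) (use B(1) in simp)
      also have "\<dots> \<le> prob (B 1) + prob (B (- 1))"
        using B(1) by (intro measure_Un_le) auto
      also have "\<dots> \<le> 4 * (W / K) + 2 * \<rho> ^ q"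
        using pB[OF W(1) \<mu>(1)] pB[OF W(2) \<mu>(2)] by simp
      also have "4 * (W / K) = \<eta> / 2" using W \<eta> by (simp add: K_def)
      finally show ?case using elim(1) by simp
    qed
  qed
qed

end
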